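(* Let $\theta_1\in\Theta_1$ be the post-change parameter and set $\mathsf{KL}_M=\max_{\tau\in[\tau_{\min},\tau_{\max}]}\mathsf{KL}(\theta_1,\tau)$, the maximum over thresholds of the Kullback-Leibler divergence between the post-change and pre-change distributions of the 1-bit measurement. Then, as $\gamma\to\infty$, $$\inf_{(\pi,\mathsf T):\ \mathsf E_\infty^\pi[\mathsf T]\ge\gamma}\mathrm{WADD}(\mathsf T)\ \ge\ \bigl(\mathsf{KL}_M^{-1}+o(1)\bigr)\log\gamma,$$ where the infimum is over all joint quantization-and-detection procedures $(\pi,\mathsf T)$ with average run length $\mathsf E_\infty^\pi[\mathsf T]$ at least $\gamma$.
   Context: Data model. $\{p_X(\cdot;\theta):\theta\in\Theta\}$, $\Theta\subset\mathbb R$, is a parametric family of densities on $\mathcal X\subseteq\mathbb R$. The independent observations $X_t\in\mathcal X$, $t=1,2,\dots$, have density $p_X(\cdot;\theta_0)$ for $t=1,\dots,\kappa$ and density $p_X(\cdot;\theta_1)$ for $t\ge\kappa+1$, where $\kappa\in\{0,1,2,\dots\}$ is a deterministic unknown change-point. The parameter $\theta_0$ is known; $\theta_1$ is unknown and belongs to a compact set $\Theta_1\subset\Theta$ with $\theta_0\notin\Theta_1$. 1-bit measurements. The $X_t$ are not observed; one observes $B_t=1$ if $X_t\le\tau_t$ and $B_t=-1$ if $X_t>\tau_t$, where the threshold $\tau_t$ lies in the interior of $\mathcal X$ and in a fixed bounded interval $[\tau_{\min},\tau_{\max}]$ with $\tau_{\min},\tau_{\max}\in\mathcal X$. For $b\in\{-1,1\}$,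 $p_B(b;\theta,\tau)$ is the probability that the bit equals $b$ when $X\sim p_X(\cdot;\theta)$ and the threshold is $\tau$: $p_B(1;\theta,\tau)=\int_{\{x\in\mathcal X:x\le\tau\}}p_X(x;\theta)\,dx$ and $p_B(-1;\theta,\tau)=\int_{\{x\in\mathcal X:x>\tau\}}p_X(x;\theta)\,dx$. 1-bit KL divergence: $\mathsf{KL}(\theta,\tau)=\sum_{b\in\{-1,1\}}p_B(b;\theta,\tau)\log\frac{p_B(b;\theta,\tau)}{p_B(b;\theta_0,\tau)}$. Joint procedures. Let $\mathscr F_t=\sigma\{B_1,\dots,B_t\}$, with $\mathscr F_0$ trivial. A joint procedure is a pair $(\pi,\mathsf T)$, where $\pi=\{\tau_t\}_{t\ge1}$ is a quantization policy such that each $\tau_t\in[\tau_{\min},\tau_{\max}]$ is $\mathscr F_{t-1}$-measurable, and $\mathsf T$ is a stopping time with respect to $\{\mathscr F_t\}$. Measures and metrics. $\mathsf P_\infty^\pi,\mathsf E_\infty^\pi$ denote probability and expectation under policy $\pi$ when all samples are pre-change ($\kappa=\infty$); $\mathsf P_\kappa^{\theta,\pi},\mathsf E_\kappa^{\theta,\pi}$ denote them when the change occurs at time $\kappa$ with post-change parameter $\theta$. The average run length is $\mathsf E_\infty^\pi[\mathsf T]$. The worst-case average detection delay is $\mathrm{WADD}(\mathsf T)=\sup_{\kappa\ge0}\operatorname{ess\,sup}\,\mathsf E_\kappa^{\theta,\pi}[(\mathsf T-\kappa)^+\mid\mathscr F_\kappa]$, evaluated at the true post-change parameter $\theta=\theta_1$.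 *)

theory Defs
  imports "HOL-Probability.Probability"
begin

text \<open>Densities are with respect to Lebesgue measure on the sample space \<open>\<X> \<subseteq> \<real>\<close>;
  a family is written \<open>p x \<theta>\<close>.\<close>

definition density_on :: "real set \<Rightarrow> (real \<Rightarrow> real) \<Rightarrow> bool" where
  "density_on \<X> f \<longleftrightarrow>
     f \<in> borel_measurable (restrict_space borel \<X>) \<and>
     (\<forall>x\<in>\<X>. 0 \<le> f x) \<and>
     (\<integral>\<^sup>+x\<in>\<X>. ennreal (f x) \<partial>lborel) = 1"

definition sample_law :: "real set \<Rightarrow> (real \<Rightarrow> real \<Rightarrow> real) \<Rightarrow> real \<Rightarrow> real measure" where
  "sample_law \<X> p \<theta> = density (restrict_space lborel \<X>) (\<lambda>x. ennreal (p x \<theta>))"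

text \<open>The probability that the bit \<open>b \<in> {-1, 1}\<close> is reported with threshold \<open>\<tau>\<close>.\<close>

definition bit_prob :: "real set \<Rightarrow> (real \<Rightarrow> real \<Rightarrow> real) \<Rightarrow> int \<Rightarrow> real \<Rightarrow> real \<Rightarrow> real" where
  "bit_prob \<X> p b \<theta> \<tau> =
     (if b = 1 then LINT x:{x\<in>\<X>. x \<le> \<tau>}|lborel. p x \<theta>
      else LINT x:{x\<in>\<X>. x > \<tau>}|lborel. p x \<theta>)"

text \<open>The summand \<open>u log (u / v)\<close> of a Kullback--Leibler divergence, with the usual conventions
  \<open>0 log (0 / v) = 0\<close> and \<open>u log (u / 0) = \<infinity>\<close> for \<open>u > 0\<close>
  (in HOL, \<open>u * ln (u / 0)\<close> would be 0).\<close>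

definition kl_term :: "real \<Rightarrow> real \<Rightarrow> ereal" where
  "kl_term u v = (if u = 0 then 0 else if v = 0 then \<infinity> else ereal (u * ln (u / v)))"

definition bit_KL :: "real set \<Rightarrow> (real \<Rightarrow> real \<Rightarrow> real) \<Rightarrow> real \<Rightarrow> real \<Rightarrow> real \<Rightarrow> ereal" where
  "bit_KL \<X> p \<theta>\<^sub>0 \<theta> \<tau> = (\<Sum>b\<in>{-1, 1}. kl_term (bit_prob \<X> p b \<theta> \<tau>) (bit_prob \<X> p b \<theta>\<^sub>0 \<tau>))"

text \<open>A path \<open>\<omega>\<close> lists the unquantized observations \<open>\<omega> t = X\<^sub>t\<close> for \<open>t \<ge> 1\<close>. The law with change-point
  \<open>\<kappa>\<close> makes them independent; \<open>\<kappa> = \<infinity>\<close> is the pre-change law, in which \<open>\<theta>\<close> plays no role.\<close>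

definition paths :: "real set \<Rightarrow> (nat \<Rightarrow> real) set" where
  "paths \<X> = {1..} \<rightarrow>\<^sub>E \<X>"

definition path_law ::
  "real set \<Rightarrow> (real \<Rightarrow> real \<Rightarrow> real) \<Rightarrow> real \<Rightarrow> real \<Rightarrow> enat \<Rightarrow> (nat \<Rightarrow> real) measure" where
  "path_law \<X> p \<theta>\<^sub>0 \<theta> \<kappa> =
     (\<Pi>\<^sub>M t\<in>{1..}. sample_law \<X> p (if enat t \<le> \<kappa> then \<theta>\<^sub>0 else \<theta>))"

text \<open>A quantization policy \<open>\<pi>\<close> is given as a process of thresholds \<open>\<pi> t \<omega> = \<tau>\<^sub>t\<close> on the path
  space. The bits, and hence the filtration they generate, depend on \<open>\<pi>\<close>.\<close>

definition bit :: "(nat \<Rightarrow> (nat \<Rightarrow> real) \<Rightarrow> real) \<Rightarrow> nat \<Rightarrow> (nat \<Rightarrow> real) \<Rightarrow> int" where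
  "bit \<pi> t \<omega> = (if \<omega> t \<le> \<pi> t \<omega> then 1 else -1)"

text \<open>Time is \<open>enat\<close>-valued, so that stopping times may be infinite;
  at \<open>\<infinity>\<close> the filtration contains all bits.\<close>

definition bit_filtration ::
  "real set \<Rightarrow> (nat \<Rightarrow> (nat \<Rightarrow> real) \<Rightarrow> real) \<Rightarrow> enat \<Rightarrow> (nat \<Rightarrow> real) measure" where
  "bit_filtration \<X> \<pi> t =
     sigma (paths \<X>) {{\<omega>\<in>paths \<X>. bit \<pi> s \<omega> = b} | s b. 1 \<le> s \<and> enat s \<le> t}"

definition quantization_policy ::
  "real set \<Rightarrow> real \<Rightarrow> real \<Rightarrow> (nat \<Rightarrow> (nat \<Rightarrow> real) \<Rightarrow> real) \<Rightarrow> bool" where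
  "quantization_policy \<X> \<tau>min \<tau>max \<pi> \<longleftrightarrow>
     (\<forall>t\<ge>1. \<pi> t \<in> borel_measurable (bit_filtration \<X> \<pi> (enat (t - 1))) \<and>
            (\<forall>\<omega>\<in>paths \<X>. \<pi> t \<omega> \<in> interior \<X> \<inter> {\<tau>min..\<tau>max}))"

definition joint_procedures ::
  "real set \<Rightarrow> real \<Rightarrow> real \<Rightarrow>
    ((nat \<Rightarrow> (nat \<Rightarrow> real) \<Rightarrow> real) \<times> ((nat \<Rightarrow> real) \<Rightarrow> enat)) set" where
  "joint_procedures \<X> \<tau>min \<tau>max =
     {(\<pi>, T). quantization_policy \<X> \<tau>min \<tau>max \<pi> \<and> stopping_time (bit_filtration \<X> \<pi>) T}"

text \<open>The pre-change law does not involve the post-change parameter; \<open>\<theta>\<^sub>0\<close> fills its place.\<close>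

definition ARL ::
  "real set \<Rightarrow> (real \<Rightarrow> real \<Rightarrow> real) \<Rightarrow> real \<Rightarrow> ((nat \<Rightarrow> real) \<Rightarrow> enat) \<Rightarrow> ennreal" where
  "ARL \<X> p \<theta>\<^sub>0 T = (\<integral>\<^sup>+\<omega>. ennreal_of_enat (T \<omega>) \<partial>path_law \<X> p \<theta>\<^sub>0 \<theta>\<^sub>0 \<infinity>)"

text \<open>Subtraction on \<open>enat\<close> is truncated, so \<open>T \<omega> - enat \<kappa>\<close> is the positive part \<open>(T - \<kappa>)\<^sup>+\<close>.\<close>

definition WADD ::
  "real set \<Rightarrow> (real \<Rightarrow> real \<Rightarrow> real) \<Rightarrow> real \<Rightarrow> real \<Rightarrow>
    (nat \<Rightarrow> (nat \<Rightarrow> real) \<Rightarrow> real) \<Rightarrow> ((nat \<Rightarrow> real) \<Rightarrow> enat) \<Rightarrow> ennreal" where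
  "WADD \<X> p \<theta>\<^sub>0 \<theta> \<pi> T =
     (SUP \<kappa>::nat. esssup (path_law \<X> p \<theta>\<^sub>0 \<theta> (enat \<kappa>))
        (nn_cond_exp (path_law \<X> p \<theta>\<^sub>0 \<theta> (enat \<kappa>)) (bit_filtration \<X> \<pi> (enat \<kappa>))
          (\<lambda>\<omega>. ennreal_of_enat (T \<omega> - enat \<kappa>))))"

end

theory Submission
  imports Defs "HOL-Real_Asymp.Real_Asymp"
begin

text \<open>
  No law of large numbers is needed. Since a policy is a function of past bits, a joint procedure is a
  binary decision tree. Write \<open>K\<close> for \<open>KL\<^sub>M\<close>. On the subtree below a history \<open>h\<close> at time
  \<open>\<kappa>\<close>, let \<open>a\<close> and \<open>b\<close> be the post- and pre-change probabilities of stopping within \<open>m\<close>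
  further bits, and \<open>d\<close> the post-change expected delay. The Donsker--Varadhan inequality, applied at
  each node, gives \<open>\<lambda> a \<le> ln (1 + (exp \<lambda> - 1) b) + K d\<close>, and Markov's inequality gives
  \<open>a \<ge> 1 - d / m\<close>. If the average run length is at least \<open>\<gamma>\<close>, some history of positive
  probability has \<open>b \<le> 2 m / \<gamma>\<close>, while the worst-case delay bounds \<open>d\<close> on every such history.
  Taking \<open>m\<close> about \<open>(ln \<gamma>)\<^sup>2\<close> and \<open>exp \<lambda>\<close> about \<open>\<gamma> / (2 m)\<close> yields
  \<open>d \<ge> (\<lambda> - ln 2) / (K + \<lambda> / m)\<close>, which is \<open>(1 / K + o(1)) ln \<gamma>\<close>.
\<close>

section \<open>Variational inequalities for a single bit\<close>

lemma kl_term_neq_MInfty: "kl_term u v \<noteq> - \<infinity>"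
  by (simp add: kl_term_def)

text \<open>This is \<open>ln x \<le> x - 1\<close> at \<open>x = v * g / (u * s)\<close>,
  multiplied by \<open>u\<close>. The free \<open>s\<close> will be the mean of \<open>g\<close>, so
  that the linear corrections cancel over the two outcomes.\<close>

lemma kl_term_variational:
  assumes "0 \<le> u" "0 \<le> v" "0 < g" "0 < s" "kl_term u v = ereal k"
  shows "u * ln g \<le> k + v * g / s - u + u * ln s"
proof (cases "u = 0")
  case True
  with assms show ?thesis by (auto simp: kl_term_def zero_ereal_def)
next
  case False
  then have pos: "u > 0" "v > 0" and k: "k = u * ln (u / v)"
    using assms by (auto simp: kl_term_def split: if_splits)
  have "ln (v * g / (u * s)) \<le> v * g / (u * s) - 1"
    using pos assms by (intro ln_le_minus_one) auto
  then have "u * ln (v * g / (u * s)) \<le> u * (v * g / (u * s) - 1)"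
    using pos by (intro mult_left_mono) auto
  also have "\<dots> = v * g / s - u"
    using pos by (simp add: field_simps)
  also have "u * ln (v * g / (u * s)) = u * ln g - k - u * ln s"
    using pos assms(3,4) k by (simp add: ln_mult ln_div algebra_simps)
  finally show ?thesis by simp
qed

text \<open>Both instances of \<open>kl_term_variational\<close> share the normaliser
  \<open>s\<close>, the mean of \<open>g\<close> under the second pair; as both pairs sum to one,
  only \<open>ln s\<close> and the divergence remain.\<close>

lemma binary_Donsker_Varadhan:
  assumes "0 \<le> q\<^sub>0" "0 \<le> q\<^sub>1" "q\<^sub>0 + q\<^sub>1 = 1" "0 \<le> p\<^sub>0" "0 \<le> p\<^sub>1" "p\<^sub>0 + p\<^sub>1 = 1"
    and "0 < g\<^sub>0" "0 < g\<^sub>1" and K: "kl_term q\<^sub>0 p\<^sub>0 + kl_term q\<^sub>1 p\<^sub>1 \<le> ereal K"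
  shows "q\<^sub>0 * ln g\<^sub>0 + q\<^sub>1 * ln g\<^sub>1 \<le> ln (p\<^sub>0 * g\<^sub>0 + p\<^sub>1 * g\<^sub>1) + K"
proof -
  define s where "s = p\<^sub>0 * g\<^sub>0 + p\<^sub>1 * g\<^sub>1"
  have s: "s > 0"
  proof (cases "p\<^sub>0 = 0")
    case False
    then have "p\<^sub>0 * g\<^sub>0 > 0" using assms by simp
    then show ?thesis using assms by (simp add: s_def add_pos_nonneg)
  qed (use assms in \<open>simp add: s_def\<close>)
  \<comment> \<open>A finite bound \<open>K\<close> forces both summands to be real, as neither can
    be \<open>-\<infinity>\<close>.\<close>
  obtain k\<^sub>0 k\<^sub>1 where k: "kl_term q\<^sub>0 p\<^sub>0 = ereal k\<^sub>0" "kl_term q\<^sub>1 p\<^sub>1 = ereal k\<^sub>1"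
    using K by (cases "kl_term q\<^sub>0 p\<^sub>0"; cases "kl_term q\<^sub>1 p\<^sub>1")
      (auto simp: kl_term_neq_MInfty)
  have "q\<^sub>0 * ln g\<^sub>0 + q\<^sub>1 * ln g\<^sub>1
      \<le> (k\<^sub>0 + p\<^sub>0 * g\<^sub>0 / s - q\<^sub>0 + q\<^sub>0 * ln s) + (k\<^sub>1 + p\<^sub>1 * g\<^sub>1 / s - q\<^sub>1 + q\<^sub>1 * ln s)"
    using assms k s by (intro add_mono kl_term_variational) auto
  also have "\<dots> = k\<^sub>0 + k\<^sub>1 + (p\<^sub>0 * g\<^sub>0 + p\<^sub>1 * g\<^sub>1) / s - (q\<^sub>0 + q\<^sub>1) + (q\<^sub>0 + q\<^sub>1) * ln s"
    by (simp add: algebra_simps add_divide_distrib)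
  also have "\<dots> = k\<^sub>0 + k\<^sub>1 + ln s"
    using assms(3) s by (simp add: s_def[symmetric])
  finally show ?thesis
    using K k by (simp add: s_def)
qed

section \<open>Decision trees\<close>

text \<open>A decision tree branches on one bit at a time: \<open>q h b\<close> is the probability that bit \<open>b\<close> follows
  the history \<open>h\<close>, and \<open>S h\<close> says that observation stops at or before \<open>h\<close>. Started from \<open>h\<close>,
  \<open>hit\<close> is the probability of stopping within \<open>j\<close> further bits, and \<open>delay\<close> is the
  expected number of further bits, capped at \<open>j\<close>.\<close>

primrec hit :: "(bool list \<Rightarrow> bool \<Rightarrow> real) \<Rightarrow> (bool list \<Rightarrow> bool) \<Rightarrow> nat \<Rightarrow> bool list \<Rightarrow> real" where
  "hit q S 0 h = of_bool (S h)"
| "hit q S (Suc j) h = (if S h then 1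
     else q h True * hit q S j (h @ [True]) + q h False * hit q S j (h @ [False]))"

primrec delay :: "(bool list \<Rightarrow> bool \<Rightarrow> real) \<Rightarrow> (bool list \<Rightarrow> bool) \<Rightarrow> nat \<Rightarrow> bool list \<Rightarrow> real" where
  "delay q S 0 h = 0"
| "delay q S (Suc j) h = (if S h then 0
     else 1 + q h True * delay q S j (h @ [True]) + q h False * delay q S j (h @ [False]))"

definition bit_kernel :: "(bool list \<Rightarrow> bool \<Rightarrow> real) \<Rightarrow> bool" where
  "bit_kernel q \<longleftrightarrow> (\<forall>h b. 0 \<le> q h b) \<and> (\<forall>h. q h True + q h False = 1)"

lemma bit_kernelD:
  assumes "bit_kernel q"
  shows "0 \<le> q h b" "q h True + q h False = 1"
  using assms by (auto simp: bit_kernel_def)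

lemma hit_nonneg: "bit_kernel q \<Longrightarrow> 0 \<le> hit q S j h"
  by (induction j arbitrary: h) (auto simp: bit_kernel_def)

lemma delay_nonneg: "bit_kernel q \<Longrightarrow> 0 \<le> delay q S j h"
  by (induction j arbitrary: h) (auto simp: bit_kernel_def add_nonneg_nonneg)

text \<open>The bit just read pays one unit of delay; the remaining \<open>j\<close> times the
  chance of a miss passes to the children, where the induction hypothesis applies.\<close>

lemma Markov_delay:
  assumes "bit_kernel q"
  shows "real j * (1 - hit q S j h) \<le> delay q S j h"
proof (induction j arbitrary: h)
  case (Suc j)
  show ?case
  proof (cases "S h")
    case False
    let ?a = "\<lambda>b. hit q S j (h @ [b])" and ?d = "\<lambda>b. delay q S j (h @ [b])"
    have 1: "q h True + q h False = 1" by (rule bit_kernelD[OF assms])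
    \<comment> \<open>The last summand is zero; with it the identity is pure algebra in
      \<open>q\<close>.\<close>
    have "real (Suc j) * (1 - hit q S (Suc j) h)
        = q h True * (real j * (1 - ?a True)) + q h False * (real j * (1 - ?a False))
          + (1 - hit q S (Suc j) h) + real j * (1 - (q h True + q h False))"
      using False by (simp add: algebra_simps)
    also have "\<dots> \<le> q h True * ?d True + q h False * ?d False + 1 + real j * 0"
    proof (intro add_mono mult_left_mono Suc.IH bit_kernelD(1)[OF assms])
      show "1 - hit q S (Suc j) h \<le> 1"
        using hit_nonneg[OF assms, of S "Suc j" h] by linarith
    qed (use 1 in auto)
    finally show ?thesis using False by simp
  qed simp
qed simp

text \<open>The argument of \<open>ln\<close> is the mean under \<open>p\<close> of
  \<open>exp l\<close> raised to the indicator of a hit. The induction is the chain rule for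
  relative entropy: every bit read before stopping costs at most \<open>K\<close>, hence the factor
  \<open>delay\<close>. At a stopped node both sides equal \<open>l\<close>.\<close>

lemma hit_change_of_measure:
  assumes q: "bit_kernel q" and p: "bit_kernel p"
    and K: "\<And>h. kl_term (q h True) (p h True) + kl_term (q h False) (p h False) \<le> ereal K"
    and l: "0 \<le> l"
  shows "l * hit q S j h \<le> ln (1 + (exp l - 1) * hit p S j h) + K * delay q S j h"
proof (induction j arbitrary: h)
  case 0
  then show ?case by simp
next
  case (Suc j)
  show ?case
  proof (cases "S h")
    case False
    let ?a = "\<lambda>b. hit q S j (h @ [b])" and ?d = "\<lambda>b. delay q S j (h @ [b])"
      and ?b = "\<lambda>b. hit p S j (h @ [b])"
    let ?g = "\<lambda>b. 1 + (exp l - 1) * ?b b"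
    have g: "?g b > 0" for b
      using l hit_nonneg[OF p] by (intro add_pos_nonneg mult_nonneg_nonneg) auto
    have "l * hit q S (Suc j) h = q h True * (l * ?a True) + q h False * (l * ?a False)"
      using False by (simp add: algebra_simps)
    also have "\<dots> \<le> q h True * (ln (?g True) + K * ?d True) + q h False * (ln (?g False) + K * ?d False)"
      using bit_kernelD(1)[OF q] by (intro add_mono mult_left_mono Suc.IH)
    also have "\<dots> = (q h True * ln (?g True) + q h False * ln (?g False))
        + K * (q h True * ?d True + q h False * ?d False)"
      by (simp add: algebra_simps)
    also have "q h True * ln (?g True) + q h False * ln (?g False)
        \<le> ln (p h True * ?g True + p h False * ?g False) + K"
      using bit_kernelD[OF q] bit_kernelD[OF p] g K by (intro binary_Donsker_Varadhan)
    \<comment> \<open>\<open>?g\<close> is affine in the hit probability and \<open>p\<close> sums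
      to one, so its mean over the children is its value at the parent.\<close>
    also have "p h True * ?g True + p h False * ?g False
        = (p h True + p h False) + (exp l - 1) * hit p S (Suc j) h"
      using False by (simp add: algebra_simps)
    also have "p h True + p h False = 1" by (rule bit_kernelD[OF p])
    finally show ?thesis using False by (simp add: algebra_simps)
  qed simp
qed

text \<open>The condition on \<open>exp l\<close> keeps the logarithm at most \<open>ln 2\<close>,
  and Markov's inequality bounds the hit probability under \<open>q\<close> below by
  \<open>1 - d / r\<close>. A real \<open>r \<le> m\<close> keeps the ceiling out of the
  asymptotics.\<close>

lemma delay_lower_bound:
  assumes q: "bit_kernel q" and p: "bit_kernel p"
    and K: "\<And>h. kl_term (q h True) (p h True) + kl_term (q h False) (p h False) \<le> ereal K"
    and l: "0 \<le> l" "exp l * hit p S m h \<le> 1" and m: "m > 0" "0 < r" "r \<le> real m"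
  shows "l - ln 2 \<le> delay q S m h * (K + l / r)"
proof -
  let ?d = "delay q S m h" and ?a = "hit q S m h"
  have d: "?d \<ge> 0" by (rule delay_nonneg[OF q])
  have "1 - ?a \<le> ?d / m"
    using Markov_delay[OF q, of m S h] m by (simp add: field_simps)
  also have "\<dots> \<le> ?d / r"
    using d m by (intro divide_left_mono) auto
  finally have "l * (1 - ?d / r) \<le> l * ?a"
    using l by (intro mult_left_mono) auto
  also have "\<dots> \<le> ln (1 + (exp l - 1) * hit p S m h) + K * ?d"
    by (rule hit_change_of_measure[OF q p K l(1)])
  also have "ln (1 + (exp l - 1) * hit p S m h) \<le> ln 2"
  proof (subst ln_le_cancel_iff)
    show "0 < 1 + (exp l - 1) * hit p S m h"
      using l hit_nonneg[OF p] by (intro add_pos_nonneg mult_nonneg_nonneg) auto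
    show "1 + (exp l - 1) * hit p S m h \<le> 2"
      using l(2) hit_nonneg[OF p, of S m h] by (simp add: algebra_simps)
  qed simp
  finally show ?thesis by (simp add: algebra_simps)
qed

text \<open>\<open>l x\<close> differs from \<open>ln x\<close> by a term of order
  \<open>ln (ln x)\<close>, and \<open>l x / (ln x)\<^sup>2\<close> tends to zero. For
  \<open>K = 0\<close> the quotient grows like \<open>ln x\<close>, which matches
  \<open>inverse 0 = \<infinity>\<close> in \<open>ereal\<close>.\<close>

lemma lower_bound_asymptotics:
  fixes K :: real
  assumes "K \<ge> 0"
  defines "l \<equiv> (\<lambda>x::real. ln (x / (2 * ((ln x)\<^sup>2 + 1))))"
  shows "((\<lambda>x. ereal ((l x - ln 2) / (K + l x / (ln x)\<^sup>2) / ln x)) \<longlongrightarrow> inverse (ereal K)) at_top"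
proof (cases "K = 0")
  case True
  have "filterlim (\<lambda>x. (l x - ln 2) / (l x / (ln x)\<^sup>2) / ln x) at_top at_top"
    unfolding l_def by real_asymp
  then have "((\<lambda>x. ereal ((l x - ln 2) / (l x / (ln x)\<^sup>2) / ln x)) \<longlongrightarrow> \<infinity>) at_top"
    unfolding tendsto_PInfty by (auto simp: filterlim_at_top_dense)
  with True show ?thesis by simp
next
  case False
  then have "K > 0" using assms by simp
  then have "((\<lambda>x. (l x - ln 2) / (K + l x / (ln x)\<^sup>2) / ln x) \<longlongrightarrow> inverse K) at_top"
    unfolding l_def by real_asymp
  with False show ?thesis by simp
qed

section \<open>The law of the bits\<close>

text \<open>\<open>True\<close> stands for the bit \<open>1\<close>, \<open>False\<close> for
  \<open>-1\<close>.\<close>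

definition bit_side :: "bool \<Rightarrow> real \<Rightarrow> real set" where
  "bit_side b c = (if b then {..c} else {c<..})"

lemma bit_side_borel [measurable]: "bit_side b c \<in> sets borel"
  by (simp add: bit_side_def)

lemma space_sample_law: "space (sample_law \<X> p \<theta>) = \<X>"
  by (simp add: sample_law_def space_restrict_space)

lemma sets_sample_law [measurable_cong]:
  "sets (sample_law \<X> p \<theta>) = sets (restrict_space borel \<X>)"
  by (simp add: sample_law_def sets_restrict_space)

lemma emeasure_sample_law:
  assumes \<X>: "\<X> \<in> sets borel" and d: "density_on \<X> (\<lambda>x. p x \<theta>)" and A: "A \<in> sets borel"
  shows "emeasure (sample_law \<X> p \<theta>) (\<X> \<inter> A)
    = (\<integral>\<^sup>+x. ennreal (indicator (\<X> \<inter> A) x * p x \<theta>) \<partial>lborel)"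
proof -
  have m: "(\<lambda>x. p x \<theta>) \<in> borel_measurable (restrict_space lborel \<X>)"
    using d by (simp add: density_on_def cong: measurable_cong_sets sets_restrict_space_cong)
  have S: "\<X> \<inter> A \<in> sets (restrict_space lborel \<X>)"
    using A by (auto simp: sets_restrict_space)
  have "emeasure (sample_law \<X> p \<theta>) (\<X> \<inter> A)
      = (\<integral>\<^sup>+x. ennreal (p x \<theta>) * indicator (\<X> \<inter> A) x \<partial>restrict_space lborel \<X>)"
    using m S unfolding sample_law_def by (subst emeasure_density) auto
  also have "\<dots> = (\<integral>\<^sup>+x. ennreal (p x \<theta>) * indicator (\<X> \<inter> A) x * indicator \<X> x \<partial>lborel)"
    using \<X> by (subst nn_integral_restrict_space) auto
  also have "\<dots> = (\<integral>\<^sup>+x. ennreal (indicator (\<X> \<inter> A) x * p x \<theta>) \<partial>lborel)"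
    by (intro nn_integral_cong) (auto split: split_indicator)
  finally show ?thesis .
qed

lemma prob_space_sample_law:
  assumes "\<X> \<in> sets borel" "density_on \<X> (\<lambda>x. p x \<theta>)"
  shows "prob_space (sample_law \<X> p \<theta>)"
proof
  have "emeasure (sample_law \<X> p \<theta>) (\<X> \<inter> UNIV)
    = (\<integral>\<^sup>+x. ennreal (indicator (\<X> \<inter> UNIV) x * p x \<theta>) \<partial>lborel)"
    using assms by (intro emeasure_sample_law) auto
  also have "\<dots> = (\<integral>\<^sup>+x\<in>\<X>. ennreal (p x \<theta>) \<partial>lborel)"
    by (intro nn_integral_cong) (auto split: split_indicator)
  finally show "emeasure (sample_law \<X> p \<theta>) (space (sample_law \<X> p \<theta>)) = 1"
    using assms by (simp add: density_on_def space_sample_law)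
qed

text \<open>\<open>density_on\<close> gives measurability on \<X> only, so the density is first cut
  off by an indicator; nonnegativity then identifies the Bochner integral with the measure.\<close>

lemma bit_prob_eq_measure:
  assumes \<X>: "\<X> \<in> sets borel" and d: "density_on \<X> (\<lambda>x. p x \<theta>)"
  shows "bit_prob \<X> p (if b then 1 else -1) \<theta> c = measure (sample_law \<X> p \<theta>) (\<X> \<inter> bit_side b c)"
proof -
  have "(\<lambda>x. p x \<theta>) \<in> borel_measurable (restrict_space borel \<X>)"
    using d by (simp add: density_on_def)
  then have m: "(\<lambda>x. indicator \<X> x * p x \<theta>) \<in> borel_measurable borel"
    using \<X> by (subst (asm) borel_measurable_restrict_space_iff) auto
  have "(\<lambda>x. indicator (bit_side b c) x * (indicator \<X> x * p x \<theta>)) \<in> borel_measurable borel"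
    by (intro borel_measurable_times m borel_measurable_indicator bit_side_borel)
  also have "(\<lambda>x. indicator (bit_side b c) x * (indicator \<X> x * p x \<theta>))
      = (\<lambda>x. indicator (\<X> \<inter> bit_side b c) x * p x \<theta>)"
    by (auto simp: fun_eq_iff split: split_indicator)
  finally have m': "(\<lambda>x. indicator (\<X> \<inter> bit_side b c) x * p x \<theta>) \<in> borel_measurable lborel"
    by simp
  have "bit_prob \<X> p (if b then 1 else -1) \<theta> c
      = (\<integral>x. indicator (\<X> \<inter> bit_side b c) x * p x \<theta> \<partial>lborel)"
    unfolding bit_prob_def set_lebesgue_integral_def bit_side_def
    by (auto intro!: Bochner_Integration.integral_cong split: split_indicator)
  also have "\<dots> = enn2real (\<integral>\<^sup>+x. ennreal (indicator (\<X> \<inter> bit_side b c) x * p x \<theta>) \<partial>lborel)"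
    using d by (intro integral_eq_nn_integral m') (auto simp: density_on_def split: split_indicator)
  finally show ?thesis
    using emeasure_sample_law[OF \<X>, of p \<theta> "bit_side b c"] d by (simp add: measure_def)
qed

lemma sample_law_sides:
  assumes "\<X> \<in> sets borel" "density_on \<X> (\<lambda>x. p x \<theta>)"
  shows "measure (sample_law \<X> p \<theta>) (\<X> \<inter> bit_side True c)
    + measure (sample_law \<X> p \<theta>) (\<X> \<inter> bit_side False c) = 1"
proof -
  interpret sample: prob_space "sample_law \<X> p \<theta>"
    using assms by (rule prob_space_sample_law)
  have *: "\<X> \<inter> bit_side b c \<in> sets (sample_law \<X> p \<theta>)" for b
    by (auto simp: sets_sample_law sets_restrict_space)
  have "sample.prob (\<X> \<inter> bit_side True c) + sample.prob (\<X> \<inter> bit_side False c)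
      = sample.prob (\<X> \<inter> bit_side True c \<union> \<X> \<inter> bit_side False c)"
    by (rule sample.finite_measure_Union[symmetric, OF * *]) (auto simp: bit_side_def)
  also have "\<X> \<inter> bit_side True c \<union> \<X> \<inter> bit_side False c = space (sample_law \<X> p \<theta>)"
    by (auto simp: bit_side_def space_sample_law)
  finally show ?thesis by (simp add: sample.prob_space)
qed

lemma space_bit_filtration: "space (bit_filtration \<X> \<pi> t) = paths \<X>"
  unfolding bit_filtration_def by (rule space_measure_of) auto

lemma sets_bit_filtration: "sets (bit_filtration \<X> \<pi> t)
    = sigma_sets (paths \<X>) {{\<omega>\<in>paths \<X>. bit \<pi> s \<omega> = b} | s b. 1 \<le> s \<and> enat s \<le> t}"
  unfolding bit_filtration_def by (rule sets_measure_of) auto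

text \<open>Two paths with equal bits lie on the same side of every generator, and this survives
  complements and countable unions. Thresholds and stopping can thus be read off the bits.\<close>

lemma bit_filtration_sameD:
  assumes "A \<in> sets (bit_filtration \<X> \<pi> t)"
    and "\<omega> \<in> paths \<X>" "\<omega>' \<in> paths \<X>"
    and "\<And>s. 1 \<le> s \<Longrightarrow> enat s \<le> t \<Longrightarrow> bit \<pi> s \<omega> = bit \<pi> s \<omega>'"
  shows "\<omega> \<in> A \<longleftrightarrow> \<omega>' \<in> A"
  using assms(1) unfolding sets_bit_filtration
proof (induction rule: sigma_sets.induct)
  case (Basic a)
  then show ?case using assms(2-4) by auto
qed (use assms(2,3) in auto)

lemma prob_space_path_law:
  assumes "\<X> \<in> sets borel" "density_on \<X> (\<lambda>x. p x \<theta>\<^sub>0)" "density_on \<X> (\<lambda>x. p x \<theta>)"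
  shows "prob_space (path_law \<X> p \<theta>\<^sub>0 \<theta> \<kappa>)"
  unfolding path_law_def using assms
  by (intro prob_space_PiM) (auto intro: prob_space_sample_law)

lemma space_path_law: "space (path_law \<X> p \<theta>\<^sub>0 \<theta> \<kappa>) = paths \<X>"
  by (auto simp: path_law_def paths_def space_PiM space_sample_law)

lemma path_coordinate_measurable:
  assumes "1 \<le> t" "\<X> \<in> sets borel"
  shows "(\<lambda>\<omega>. \<omega> t) \<in> borel_measurable (path_law \<X> p \<theta>\<^sub>0 \<theta> \<kappa>)"
proof -
  have "(\<lambda>\<omega>. \<omega> t) \<in> path_law \<X> p \<theta>\<^sub>0 \<theta> \<kappa> \<rightarrow>\<^sub>M restrict_space borel \<X>"
    unfolding path_law_def using assms
    by (subst measurable_cong_sets[OF refl sets_sample_law[symmetric]])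
      (rule measurable_component_singleton, simp)
  then show ?thesis by (auto dest: measurable_restrict_space2_iff[THEN iffD1])
qed

section \<open>A joint procedure as a decision tree\<close>

locale one_bit_procedure =
  fixes \<X> :: "real set" and p :: "real \<Rightarrow> real \<Rightarrow> real" and \<theta>\<^sub>0 \<theta>\<^sub>1 \<tau>min \<tau>max :: real
    and \<pi> :: "nat \<Rightarrow> (nat \<Rightarrow> real) \<Rightarrow> real" and T :: "(nat \<Rightarrow> real) \<Rightarrow> enat"
  assumes borel_\<X>: "\<X> \<in> sets borel"
    and density_pre: "density_on \<X> (\<lambda>x. p x \<theta>\<^sub>0)" and density_post: "density_on \<X> (\<lambda>x. p x \<theta>\<^sub>1)"
    and \<tau>_le: "\<tau>min \<le> \<tau>max"
    and procedure: "(\<pi>, T) \<in> joint_procedures \<X> \<tau>min \<tau>max"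
begin

abbreviation "law \<equiv> path_law \<X> p \<theta>\<^sub>0 \<theta>\<^sub>1"

abbreviation "\<F> t \<equiv> bit_filtration \<X> \<pi> (enat t)"

lemma policy: "quantization_policy \<X> \<tau>min \<tau>max \<pi>"
  and stopping: "stopping_time (bit_filtration \<X> \<pi>) T"
  using procedure by (auto simp: joint_procedures_def)

lemma density_at: "density_on \<X> (\<lambda>x. p x (if Q then \<theta>\<^sub>0 else \<theta>\<^sub>1))"
  using density_pre density_post by simp

sublocale law: prob_space "law \<kappa>" for \<kappa>
  by (intro prob_space_path_law borel_\<X> density_pre density_post)

text \<open>Thresholds and bits are defined through each other: \<open>\<pi> t\<close> is measurable
  for the bits before \<open>t\<close>, and these are events of the path law by the induction
  hypothesis.\<close>

lemma bit_measurable: "1 \<le> t \<Longrightarrow> {\<omega>\<in>paths \<X>. bit \<pi> t \<omega> = b} \<in> sets (law \<kappa>)"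
proof (induction t arbitrary: b rule: less_induct)
  case (less t)
  have sub: "sets (\<F> (t - 1)) \<subseteq> sets (law \<kappa>)"
    unfolding sets_bit_filtration space_path_law[symmetric, of \<X> p \<theta>\<^sub>0 \<theta>\<^sub>1 \<kappa>]
  proof (rule sets.sigma_sets_subset, safe)
    fix s b assume "1 \<le> s" "enat s \<le> enat (t - 1)"
    then show "{\<omega> \<in> space (law \<kappa>). bit \<pi> s \<omega> = b} \<in> sets (law \<kappa>)"
      using less by (simp add: space_path_law)
  qed
  have "\<pi> t \<in> borel_measurable (\<F> (t - 1))"
    using policy less.prems by (simp add: quantization_policy_def)
  then have [measurable]: "\<pi> t \<in> borel_measurable (law \<kappa>)"
    by (rule borel_measurable_subalgebra[OF sub, rotated])
      (simp add: space_path_law space_bit_filtration)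
  have [measurable]: "(\<lambda>\<omega>. \<omega> t) \<in> borel_measurable (law \<kappa>)"
    using less.prems borel_\<X> by (rule path_coordinate_measurable)
  have "{\<omega>\<in>space (law \<kappa>). bit \<pi> t \<omega> = b} \<in> sets (law \<kappa>)"
    unfolding bit_def by measurable
  then show ?case by (simp add: space_path_law)
qed

lemma subalgebra_filtration: "subalgebra (law \<kappa>) (bit_filtration \<X> \<pi> t)"
  unfolding subalgebra_def sets_bit_filtration space_bit_filtration space_path_law
proof (intro conjI refl)
  show "sigma_sets (paths \<X>) {{\<omega> \<in> paths \<X>. bit \<pi> s \<omega> = b} |s b. 1 \<le> s \<and> enat s \<le> t}
      \<subseteq> sets (law \<kappa>)"
    using sets.sigma_sets_subset[of
        "{{\<omega> \<in> paths \<X>. bit \<pi> s \<omega> = b} |s b. 1 \<le> s \<and> enat s \<le> t}" "law \<kappa>"] bit_measurable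
    by (auto simp: space_path_law)
qed

lemma T_le_sets: "{\<omega>\<in>paths \<X>. T \<omega> \<le> enat n} \<in> sets (\<F> n)"
  using stopping_timeD[OF stopping, of "enat n"]
  by (simp add: Measurable.pred_def space_bit_filtration)

lemma T_measurable [measurable]: "T \<in> law \<kappa> \<rightarrow>\<^sub>M count_space UNIV"
proof -
  have le: "{\<omega>\<in>paths \<X>. T \<omega> \<le> enat n} \<in> sets (law \<kappa>)" for n
    using T_le_sets[of n] subalgebra_filtration[of \<kappa> "enat n"]
    unfolding subalgebra_def by blast
  have "T \<in> borel_measurable (law \<kappa>)"
  proof (rule borel_measurableI_le)
    fix y show "{\<omega> \<in> space (law \<kappa>). T \<omega> \<le> y} \<in> sets (law \<kappa>)"
      using le sets.top[of "law \<kappa>"] by (cases y) (auto simp: space_path_law)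
  qed
  then show ?thesis
    by (subst (asm) measurable_cong_sets[OF refl sets_borel_eq_count_space])
qed

definition history :: "nat \<Rightarrow> (nat \<Rightarrow> real) \<Rightarrow> bool list" where
  "history n \<omega> = map (\<lambda>t. \<omega> (Suc t) \<le> \<pi> (Suc t) \<omega>) [0..<n]"

definition cylinder :: "bool list \<Rightarrow> (nat \<Rightarrow> real) set" where
  "cylinder h = {\<omega> \<in> paths \<X>. history (length h) \<omega> = h}"

lemma length_history [simp]: "length (history n \<omega>) = n"
  by (simp add: history_def)

lemma history_Suc: "history (Suc n) \<omega> = history n \<omega> @ [\<omega> (Suc n) \<le> \<pi> (Suc n) \<omega>]"
  by (simp add: history_def)

lemma bit_eq_if_history_eq:
  assumes "history n \<omega> = history n \<omega>'" "1 \<le> s" "s \<le> n"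
  shows "bit \<pi> s \<omega> = bit \<pi> s \<omega>'"
proof -
  have "history n \<omega> ! (s - 1) = history n \<omega>' ! (s - 1)" using assms by simp
  then show ?thesis using assms(2,3) by (simp add: history_def bit_def)
qed

lemma filtration_history_cong:
  assumes "A \<in> sets (\<F> n)" "\<omega> \<in> paths \<X>" "\<omega>' \<in> paths \<X>" "history n \<omega> = history n \<omega>'"
  shows "\<omega> \<in> A \<longleftrightarrow> \<omega>' \<in> A"
  using assms by (intro bit_filtration_sameD) (auto intro: bit_eq_if_history_eq)

text \<open>On the empty cylinder, where the policy prescribes nothing, \<open>\<tau>min\<close> is an arbitrary
  admissible threshold.\<close>

definition threshold :: "bool list \<Rightarrow> real" where
  "threshold h = (if cylinder h = {} then \<tau>min
     else \<pi> (Suc (length h)) (SOME \<omega>. \<omega> \<in> cylinder h))"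

text \<open>On a nonempty cylinder any path gives the same answer, by \<open>stopped_iff\<close>; an
  empty one counts as not stopped.\<close>

definition stopped :: "bool list \<Rightarrow> bool" where
  "stopped h \<longleftrightarrow> (\<exists>\<omega>\<in>cylinder h. T \<omega> \<le> enat (length h))"

text \<open>Defined on all histories, even impossible ones, so that \<open>bit_kernel\<close> holds
  outright.\<close>

definition kernel :: "real \<Rightarrow> bool list \<Rightarrow> bool \<Rightarrow> real" where
  "kernel \<theta> h b = measure (sample_law \<X> p \<theta>) (\<X> \<inter> bit_side b (threshold h))"

text \<open>A level set of \<open>\<pi> (Suc (length h))\<close> belongs to the filtration at
  \<open>length h\<close>, so it contains the whole cylinder or misses it.\<close>

lemma policy_eq_threshold:
  assumes "\<omega> \<in> cylinder h"
  shows "\<pi> (Suc (length h)) \<omega> = threshold h"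
proof -
  define \<omega>' where "\<omega>' = (SOME \<omega>. \<omega> \<in> cylinder h)"
  have \<omega>': "\<omega>' \<in> cylinder h" using assms unfolding \<omega>'_def by (auto simp: some_in_eq)
  let ?n = "length h"
  have "\<pi> (Suc ?n) \<in> borel_measurable (\<F> ?n)"
    using policy[unfolded quantization_policy_def, rule_format, of "Suc ?n"] by simp
  then have "\<pi> (Suc ?n) -` {\<pi> (Suc ?n) \<omega>'} \<inter> space (\<F> ?n) \<in> sets (\<F> ?n)"
    by (rule measurable_sets) simp
  from filtration_history_cong[OF this, of \<omega> \<omega>'] assms \<omega>'
  have "\<pi> (Suc ?n) \<omega> = \<pi> (Suc ?n) \<omega>'"
    by (auto simp: cylinder_def space_bit_filtration)
  with assms show ?thesis by (auto simp: threshold_def \<omega>'_def)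
qed

lemma threshold_bounds: "threshold h \<in> {\<tau>min..\<tau>max}"
proof (cases "cylinder h = {}")
  case False
  then obtain \<omega> where "\<omega> \<in> cylinder h" by auto
  moreover from this have "\<pi> (Suc (length h)) \<omega> \<in> {\<tau>min..\<tau>max}"
    using policy by (auto simp: quantization_policy_def cylinder_def)
  ultimately show ?thesis by (simp add: policy_eq_threshold)
qed (use \<tau>_le in \<open>simp add: threshold_def\<close>)

lemma stopped_iff:
  assumes "\<omega> \<in> cylinder h"
  shows "stopped h \<longleftrightarrow> T \<omega> \<le> enat (length h)"
proof
  assume "stopped h"
  then obtain \<omega>' where "\<omega>' \<in> cylinder h" "T \<omega>' \<le> enat (length h)"
    by (auto simp: stopped_def)
  with filtration_history_cong[OF T_le_sets, of \<omega> \<omega>' "length h"] assms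
  show "T \<omega> \<le> enat (length h)" by (auto simp: cylinder_def)
qed (use assms in \<open>auto simp: stopped_def\<close>)

lemma bit_kernel_kernel:
  assumes "density_on \<X> (\<lambda>x. p x \<theta>)"
  shows "bit_kernel (kernel \<theta>)"
  using sample_law_sides[OF borel_\<X>, of p \<theta>] assms by (auto simp: bit_kernel_def kernel_def)

lemma kernel_eq_bit_prob:
  assumes "density_on \<X> (\<lambda>x. p x \<theta>)"
  shows "kernel \<theta> h b = bit_prob \<X> p (if b then 1 else -1) \<theta> (threshold h)"
  unfolding kernel_def using borel_\<X> assms by (rule bit_prob_eq_measure[symmetric])

section \<open>Cylinders as boxes and their probabilities\<close>

lemma cylinder_snoc:
  "cylinder (h @ [b]) = {\<omega> \<in> cylinder h. \<omega> (Suc (length h)) \<in> bit_side b (threshold h)}"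
  using policy_eq_threshold[of _ h]
  by (auto simp: cylinder_def history_Suc bit_side_def)

lemma cylinder_split: "cylinder h = cylinder (h @ [True]) \<union> cylinder (h @ [False])"
  "cylinder (h @ [True]) \<inter> cylinder (h @ [False]) = {}"
  by (auto simp: cylinder_def history_Suc)

text \<open>Along a fixed history the random thresholds become constants, so the cylinder constrains
  each coordinate separately and the product measure factorises on it.\<close>

lemma cylinder_eq_box: "cylinder h
  = {\<omega> \<in> paths \<X>. \<forall>t\<in>{1..length h}. \<omega> t \<in> \<X> \<inter> bit_side (h ! (t - 1)) (threshold (take (t - 1) h))}"
proof (induction h rule: rev_induct)
  case Nil
  then show ?case by (auto simp: cylinder_def history_def)
next
  case (snoc b h)
  have *: "{1..length (h @ [b])} = insert (Suc (length h)) {1..length h}" by auto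
  have "\<omega> \<in> paths \<X> \<Longrightarrow> \<omega> (Suc (length h)) \<in> \<X>" for \<omega>
    by (auto simp: paths_def)
  moreover have "t \<in> {1..length h} \<Longrightarrow> (h @ [b]) ! (t - 1) = h ! (t - 1)
      \<and> take (t - 1) (h @ [b]) = take (t - 1) h" for t
    by (auto simp: nth_append)
  ultimately show ?case
    unfolding cylinder_snoc snoc.IH * by auto
qed

lemma emeasure_cylinder: "emeasure (law \<kappa>) (cylinder h)
  = (\<Prod>t\<in>{1..length h}. ennreal (kernel (if enat t \<le> \<kappa> then \<theta>\<^sub>0 else \<theta>\<^sub>1) (take (t - 1) h) (h ! (t - 1))))"
proof -
  let ?\<theta> = "\<lambda>t. if enat t \<le> \<kappa> then \<theta>\<^sub>0 else \<theta>\<^sub>1"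
  let ?M = "\<lambda>t. sample_law \<X> p (?\<theta> t)"
  interpret product_prob_space ?M "{1..}"
    by (rule product_prob_spaceI) (intro prob_space_sample_law borel_\<X> density_at)
  have "emeasure (law \<kappa>) (cylinder h) = (\<Prod>t\<in>{1..length h}.
      emeasure (?M t) (\<X> \<inter> bit_side (h ! (t - 1)) (threshold (take (t - 1) h))))"
    unfolding cylinder_eq_box space_path_law[symmetric, of \<X> p \<theta>\<^sub>0 \<theta>\<^sub>1 \<kappa>] path_law_def
    by (rule emeasure_PiM_Collect) (auto simp: sets_sample_law sets_restrict_space)
  also have "\<dots> = (\<Prod>t\<in>{1..length h}. ennreal (kernel (?\<theta> t) (take (t - 1) h) (h ! (t - 1))))"
    by (simp add: kernel_def M.emeasure_eq_measure)
  finally show ?thesis .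
qed

text \<open>The next bit arrives at time \<open>Suc (length h)\<close>, so for
  \<open>\<kappa> = length h\<close> it already follows the post-change kernel.\<close>

lemma emeasure_cylinder_snoc: "emeasure (law \<kappa>) (cylinder (h @ [b])) =
  emeasure (law \<kappa>) (cylinder h) * ennreal (kernel (if enat (Suc (length h)) \<le> \<kappa> then \<theta>\<^sub>0 else \<theta>\<^sub>1) h b)"
proof -
  have *: "{1..length (h @ [b])} = insert (Suc (length h)) {1..length h}" by auto
  have "(\<Prod>t\<in>{1..length h}. ennreal (kernel (if enat t \<le> \<kappa> then \<theta>\<^sub>0 else \<theta>\<^sub>1)
      (take (t - 1) (h @ [b])) ((h @ [b]) ! (t - 1)))) = emeasure (law \<kappa>) (cylinder h)"
    unfolding emeasure_cylinder by (intro prod.cong) (auto simp: nth_append)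
  then show ?thesis
    unfolding emeasure_cylinder[of _ "h @ [b]"] * by (subst prod.insert) (auto simp: mult.commute)
qed

text \<open>Carries positivity from the pre-change law, where a suitable history is found, to the
  law changing at \<open>length h\<close>, where its delay is measured.\<close>

lemma emeasure_cylinder_pre:
  assumes "enat (length h) \<le> \<kappa>"
  shows "emeasure (law \<kappa>) (cylinder h) = emeasure (law \<infinity>) (cylinder h)"
proof -
  have "enat t \<le> \<kappa>" if "t \<in> {1..length h}" for t
    using that assms by (cases \<kappa>) auto
  then show ?thesis
    unfolding emeasure_cylinder by (intro prod.cong) auto
qed

lemma cylinder_sets_filtration: "length h \<le> n \<Longrightarrow> cylinder h \<in> sets (\<F> n)"
proof (induction h rule: rev_induct)
  case Nil
  have "space (\<F> n) \<in> sets (\<F> n)" by (rule sets.top)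
  then show ?case by (simp add: cylinder_def history_def space_bit_filtration)
next
  case (snoc b h)
  let ?B = "{\<omega>\<in>paths \<X>. bit \<pi> (Suc (length h)) \<omega> = (if b then 1 else -1)}"
  have "?B \<in> sets (\<F> n)"
    unfolding sets_bit_filtration using snoc.prems by (intro sigma_sets.Basic) auto
  moreover have "cylinder (h @ [b]) = cylinder h \<inter> ?B"
    by (auto simp: cylinder_def history_Suc bit_def split: if_splits)
  ultimately show ?case using snoc by auto
qed

lemma cylinder_sets [measurable]: "cylinder h \<in> sets (law \<kappa>)"
  using cylinder_sets_filtration[OF order.refl, of h] subalgebra_filtration[of \<kappa> "enat (length h)"]
  unfolding subalgebra_def by blast

section \<open>Run length and detection delay\<close>

lemma T_le_measurable [measurable]: "{\<omega> \<in> cylinder h. T \<omega> \<le> enat n} \<in> sets (law \<kappa>)"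
proof -
  have "{\<omega> \<in> cylinder h. T \<omega> \<le> enat n} = cylinder h \<inter> {\<omega> \<in> space (law \<kappa>). T \<omega> \<le> enat n}"
    by (auto simp: space_path_law cylinder_def)
  then show ?thesis by simp
qed

text \<open>Both sides obey the recursion of \<open>hit\<close>, since a cylinder is the disjoint
  union of its two children.\<close>

lemma emeasure_hit: "emeasure (law \<infinity>) {\<omega> \<in> cylinder h. T \<omega> \<le> enat (length h + j)}
  = emeasure (law \<infinity>) (cylinder h) * ennreal (hit (kernel \<theta>\<^sub>0) stopped j h)"
proof (induction j arbitrary: h)
  case 0
  have "{\<omega> \<in> cylinder h. T \<omega> \<le> enat (length h)} = (if stopped h then cylinder h else {})"
    by (auto simp: stopped_iff)
  then show ?case by simp
next
  case (Suc j)
  let ?n = "length h + Suc j"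
  show ?case
  proof (cases "stopped h")
    case True
    have "T \<omega> \<le> enat ?n" if "\<omega> \<in> cylinder h" for \<omega>
      using True stopped_iff[OF that] by (auto elim: order.trans)
    then have "{\<omega> \<in> cylinder h. T \<omega> \<le> enat ?n} = cylinder h" by auto
    with True show ?thesis by simp
  next
    case False
    let ?C = "\<lambda>b. {\<omega> \<in> cylinder (h @ [b]). T \<omega> \<le> enat ?n}"
    have C: "emeasure (law \<infinity>) (?C b) = emeasure (law \<infinity>) (cylinder h)
        * ennreal (kernel \<theta>\<^sub>0 h b * hit (kernel \<theta>\<^sub>0) stopped j (h @ [b]))" for b
      using Suc.IH[of "h @ [b]"] bit_kernelD(1)[OF bit_kernel_kernel[OF density_pre]]
      by (simp add: emeasure_cylinder_snoc ennreal_mult' mult.assoc)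
    have "{\<omega> \<in> cylinder h. T \<omega> \<le> enat ?n} = ?C True \<union> ?C False"
      by (subst cylinder_split) auto
    also have "emeasure (law \<infinity>) \<dots> = emeasure (law \<infinity>) (?C True) + emeasure (law \<infinity>) (?C False)"
      using cylinder_split(2)[of h] by (intro plus_emeasure[symmetric] T_le_measurable) auto
    also have "\<dots> = emeasure (law \<infinity>) (cylinder h) * ennreal (hit (kernel \<theta>\<^sub>0) stopped (Suc j) h)"
      using False bit_kernel_kernel[OF density_pre] unfolding C
      by (simp add: distrib_left[symmetric] ennreal_plus[symmetric] hit_nonneg bit_kernel_def
          del: ennreal_plus)
    finally show ?thesis .
  qed
qed

text \<open>Only an inequality, because \<open>delay\<close> is capped at \<open>j\<close>. In the
  induction \<open>\<kappa>\<close> stays fixed while \<open>h\<close> grows, so every further bit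
  is post-change.\<close>

lemma delay_le_nn_integral:
  assumes "\<kappa> \<le> length h"
  shows "emeasure (law (enat \<kappa>)) (cylinder h) * ennreal (delay (kernel \<theta>\<^sub>1) stopped j h)
    \<le> (\<integral>\<^sup>+\<omega>. indicator (cylinder h) \<omega> * ennreal_of_enat (T \<omega> - enat (length h)) \<partial>law (enat \<kappa>))"
  using assms
proof (induction j arbitrary: h)
  case (Suc j)
  let ?M = "law (enat \<kappa>)" and ?n = "length h"
  show ?case
  proof (cases "stopped h")
    case False
    let ?d = "\<lambda>b. delay (kernel \<theta>\<^sub>1) stopped j (h @ [b])"
      and ?i = "\<lambda>b \<omega>. indicator (cylinder (h @ [b])) \<omega> * ennreal_of_enat (T \<omega> - enat (Suc ?n))"
    have d: "emeasure ?M (cylinder h) * ennreal (kernel \<theta>\<^sub>1 h b * ?d b) \<le> (\<integral>\<^sup>+\<omega>. ?i b \<omega> \<partial>?M)" for b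
      using Suc.IH[of "h @ [b]"] bit_kernelD(1)[OF bit_kernel_kernel[OF density_post]] Suc.prems
      by (simp add: emeasure_cylinder_snoc ennreal_mult' mult.assoc)
    have "emeasure ?M (cylinder h) * ennreal (delay (kernel \<theta>\<^sub>1) stopped (Suc j) h)
        = emeasure ?M (cylinder h) + emeasure ?M (cylinder h) * ennreal (kernel \<theta>\<^sub>1 h True * ?d True)
          + emeasure ?M (cylinder h) * ennreal (kernel \<theta>\<^sub>1 h False * ?d False)"
      using False bit_kernel_kernel[OF density_post]
      by (simp add: distrib_left ennreal_plus delay_nonneg bit_kernel_def add.assoc)
    also have "\<dots> \<le> (\<integral>\<^sup>+\<omega>. indicator (cylinder h) \<omega> \<partial>?M) + (\<integral>\<^sup>+\<omega>. ?i True \<omega> \<partial>?M)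
        + (\<integral>\<^sup>+\<omega>. ?i False \<omega> \<partial>?M)"
      using d by (intro add_mono) (auto simp: nn_integral_indicator)
    also have "\<dots> = (\<integral>\<^sup>+\<omega>. indicator (cylinder h) \<omega> + ?i True \<omega> + ?i False \<omega> \<partial>?M)"
      by (simp add: nn_integral_add)
    also have "\<dots> \<le> (\<integral>\<^sup>+\<omega>. indicator (cylinder h) \<omega> * ennreal_of_enat (T \<omega> - enat ?n) \<partial>?M)"
    proof (rule nn_integral_mono)
      fix \<omega>
      \<comment> \<open>Not being stopped means \<open>T \<omega> > length h\<close>, so the two
        truncated differences differ by exactly one.\<close>
      have "1 + ennreal_of_enat (T \<omega> - enat (Suc ?n)) \<le> ennreal_of_enat (T \<omega> - enat ?n)"
        if "\<omega> \<in> cylinder h"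
      proof (cases "T \<omega>")
        case (enat t)
        then have "t > ?n" using stopped_iff[OF that] False by simp
        then have "t - ?n = Suc (t - Suc ?n)" by simp
        then show ?thesis using enat by simp
      qed simp
      then show "indicator (cylinder h) \<omega> + ?i True \<omega> + ?i False \<omega>
          \<le> indicator (cylinder h) \<omega> * ennreal_of_enat (T \<omega> - enat ?n)"
        using cylinder_split[of h] by (auto split: split_indicator)
    qed
    finally show ?thesis .
  qed simp
qed simp

text \<open>With the change placed at \<open>length h\<close>, the cylinder is an event of the
  conditioning filtration; integrating over it and dividing by its positive probability bounds the
  mean delay there by the essential supremum.\<close>

lemma delay_le_WADD:
  assumes "emeasure (law \<infinity>) (cylinder h) > 0"
  shows "ennreal (delay (kernel \<theta>\<^sub>1) stopped j h) \<le> WADD \<X> p \<theta>\<^sub>0 \<theta>\<^sub>1 \<pi> T"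
proof -
  let ?\<kappa> = "length h" and ?d = "ennreal (delay (kernel \<theta>\<^sub>1) stopped j h)"
  let ?M = "law (enat ?\<kappa>)" and ?F = "\<F> (length h)" and ?f = "\<lambda>\<omega>. ennreal_of_enat (T \<omega> - enat ?\<kappa>)"
  let ?e = "esssup ?M (nn_cond_exp ?M ?F ?f)"
  have sub: "sigma_finite_subalgebra ?M ?F"
    by (intro finite_measure_subalgebra_is_sigma_finite finite_measure_subalgebra.intro
        finite_measure_subalgebra_axioms.intro law.finite_measure_axioms subalgebra_filtration)
  have pos: "emeasure ?M (cylinder h) > 0"
    using assms emeasure_cylinder_pre[of h "enat (length h)"] by simp
  have [measurable]: "(indicator (cylinder h) :: _ \<Rightarrow> ennreal) \<in> borel_measurable ?F"
    by (rule borel_measurable_indicator, rule cylinder_sets_filtration) simp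
  have "emeasure ?M (cylinder h) * ?d \<le> (\<integral>\<^sup>+\<omega>. indicator (cylinder h) \<omega> * ?f \<omega> \<partial>?M)"
    by (rule delay_le_nn_integral) simp
  also have "\<dots> = (\<integral>\<^sup>+\<omega>. indicator (cylinder h) \<omega> * nn_cond_exp ?M ?F ?f \<omega> \<partial>?M)"
    by (rule sigma_finite_subalgebra.nn_cond_exp_intg[OF sub, symmetric]) measurable
  also have "\<dots> \<le> (\<integral>\<^sup>+\<omega>. indicator (cylinder h) \<omega> * ?e \<partial>?M)"
    using esssup_AE[of "nn_cond_exp ?M ?F ?f" ?M]
    by (intro nn_integral_mono_AE) (auto elim!: eventually_mono intro: mult_left_mono)
  also have "\<dots> = emeasure ?M (cylinder h) * ?e"
    by (simp add: nn_integral_multc)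
  finally have "?d \<le> ?e"
    using pos by (subst (asm) ennreal_mult_le_mult_iff) (auto simp: law.emeasure_eq_measure)
  also have "?e \<le> WADD \<X> p \<theta>\<^sub>0 \<theta>\<^sub>1 \<pi> T"
    unfolding WADD_def by (rule SUP_upper) simp
  finally show ?thesis .
qed

text \<open>\<open>P\<close> is free so that one decomposition serves both \<open>T > n\<close> and
  the window \<open>n < T \<le> n + m\<close>.\<close>

lemma union_cylinders:
  "{\<omega> \<in> paths \<X>. enat n < T \<omega> \<and> P \<omega>}
    = (\<Union>h\<in>{h. length h = n \<and> \<not> stopped h}. {\<omega> \<in> cylinder h. P \<omega>})"
proof -
  have own: "\<omega> \<in> cylinder (history n \<omega>)" if "\<omega> \<in> paths \<X>" for \<omega>
    using that by (simp add: cylinder_def)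
  show ?thesis
  proof (intro subset_antisym subsetI)
    fix \<omega> assume "\<omega> \<in> {\<omega> \<in> paths \<X>. enat n < T \<omega> \<and> P \<omega>}"
    then show "\<omega> \<in> (\<Union>h\<in>{h. length h = n \<and> \<not> stopped h}. {\<omega> \<in> cylinder h. P \<omega>})"
      using own by (intro UN_I[of "history n \<omega>"]) (auto simp: stopped_iff[OF own])
  next
    fix \<omega> assume "\<omega> \<in> (\<Union>h\<in>{h. length h = n \<and> \<not> stopped h}. {\<omega> \<in> cylinder h. P \<omega>})"
    then show "\<omega> \<in> {\<omega> \<in> paths \<X>. enat n < T \<omega> \<and> P \<omega>}"
      using stopped_iff[of \<omega>] by (auto simp: not_le) (auto simp: cylinder_def)
  qed
qed

lemma finite_histories: "finite {h :: bool list. length h = n \<and> Q h}"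
  by (rule finite_subset[OF _ finite_lists_length_eq[of UNIV n]]) auto

lemma disjoint_cylinders: "disjoint_family_on (\<lambda>h. {\<omega> \<in> cylinder h. P \<omega>}) {h. length h = n \<and> Q h}"
  by (auto simp: disjoint_family_on_def cylinder_def)

text \<open>Sum over the finitely many unstopped histories of length \<open>n\<close>. Null
  histories contribute nothing, so the bound is asked only where the probability is
  positive.\<close>

lemma window_probability:
  assumes hit: "\<And>h. \<not> stopped h \<Longrightarrow> emeasure (law \<infinity>) (cylinder h) > 0
      \<Longrightarrow> \<beta> \<le> hit (kernel \<theta>\<^sub>0) stopped m h"
  shows "ennreal \<beta> * emeasure (law \<infinity>) {\<omega> \<in> paths \<X>. enat n < T \<omega>}
    \<le> emeasure (law \<infinity>) {\<omega> \<in> paths \<X>. enat n < T \<omega> \<and> T \<omega> \<le> enat (n + m)}"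
proof -
  let ?H = "{h. length h = n \<and> \<not> stopped h}"
  have "emeasure (law \<infinity>) {\<omega> \<in> paths \<X>. enat n < T \<omega>} = (\<Sum>h\<in>?H. emeasure (law \<infinity>) (cylinder h))"
    using union_cylinders[of n "\<lambda>_. True"] disjoint_cylinders[of "\<lambda>_. True" n "\<lambda>h. \<not> stopped h"]
    by (subst sum_emeasure) (auto simp: finite_histories)
  then have "ennreal \<beta> * emeasure (law \<infinity>) {\<omega> \<in> paths \<X>. enat n < T \<omega>}
      = (\<Sum>h\<in>?H. emeasure (law \<infinity>) (cylinder h) * ennreal \<beta>)"
    by (simp add: sum_distrib_left mult.commute)
  also have "\<dots> \<le> (\<Sum>h\<in>?H. emeasure (law \<infinity>) {\<omega> \<in> cylinder h. T \<omega> \<le> enat (n + m)})"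
  proof (rule sum_mono)
    fix h assume h: "h \<in> ?H"
    then have "emeasure (law \<infinity>) (cylinder h) * ennreal \<beta>
        \<le> emeasure (law \<infinity>) (cylinder h) * ennreal (hit (kernel \<theta>\<^sub>0) stopped m h)"
      using hit[of h] by (cases "emeasure (law \<infinity>) (cylinder h) = 0")
        (auto intro!: mult_left_mono ennreal_leI simp: zero_less_iff_neq_zero)
    with h show "emeasure (law \<infinity>) (cylinder h) * ennreal \<beta>
        \<le> emeasure (law \<infinity>) {\<omega> \<in> cylinder h. T \<omega> \<le> enat (n + m)}"
      using emeasure_hit[of h m] by simp
  qed
  also have "\<dots> = emeasure (law \<infinity>) {\<omega> \<in> paths \<X>. enat n < T \<omega> \<and> T \<omega> \<le> enat (n + m)}"
    unfolding union_cylinders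
    by (rule sum_emeasure) (auto simp: finite_histories disjoint_cylinders)
  finally show ?thesis .
qed

text \<open>Every path has at most \<open>m\<close> times \<open>n\<close> with \<open>n < T \<le> n + m\<close>, so summing over \<open>n\<close> bounds the
  average run length by \<open>m / \<beta>\<close> if each such window catches \<open>T\<close> with conditional probability
  at least \<open>\<beta>\<close>.\<close>

lemma sum_windows_le: "(\<Sum>n. emeasure (law \<infinity>) {\<omega> \<in> paths \<X>. enat n < T \<omega> \<and> T \<omega> \<le> enat (n + m)})
  \<le> ennreal (real m)"
proof -
  define W where "W n = {\<omega> \<in> space (law \<infinity>). enat n < T \<omega> \<and> T \<omega> \<le> enat (n + m)}" for n
  have [measurable]: "W n \<in> sets (law \<infinity>)" for n
    unfolding W_def by measurable
  have "(\<Sum>n. emeasure (law \<infinity>) (W n)) = (\<integral>\<^sup>+\<omega>. (\<Sum>n. indicator (W n) \<omega>) \<partial>law \<infinity>)"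
    by (subst nn_integral_suminf) auto
  also have "\<dots> \<le> (\<integral>\<^sup>+\<omega>. ennreal (real m) \<partial>law \<infinity>)"
  proof (rule nn_integral_mono)
    fix \<omega>
    show "(\<Sum>n. indicator (W n) \<omega>) \<le> ennreal (real m)"
    proof (cases "T \<omega>")
      case (enat t)
      \<comment> \<open>Window \<open>n\<close> contains \<open>t\<close> exactly for
        \<open>t - m \<le> n < t\<close>: at most \<open>m\<close> indices, also when
        \<open>t - m\<close> is truncated at 0.\<close>
      have "(\<Sum>n. indicator (W n) \<omega> :: ennreal) = (\<Sum>n\<in>{t - m..<t}. indicator (W n) \<omega>)"
        by (rule suminf_finite) (auto simp: W_def enat split: split_indicator)
      also have "\<dots> \<le> (\<Sum>n\<in>{t - m..<t}. 1)"
        by (intro sum_mono) (auto split: split_indicator)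
      also have "\<dots> \<le> ennreal (real m)"
        by (auto simp: ennreal_of_nat_eq_real_of_nat intro!: ennreal_leI)
      finally show ?thesis .
    qed (simp add: W_def)
  qed
  also have "\<dots> = ennreal (real m)"
    by (simp add: law.emeasure_space_1)
  finally show ?thesis by (simp add: W_def space_path_law)
qed

text \<open>Tail-sum formula for the mean of an \<open>enat\<close>-valued time.\<close>

lemma ARL_eq: "ARL \<X> p \<theta>\<^sub>0 T = (\<Sum>n. emeasure (law \<infinity>) {\<omega> \<in> paths \<X>. enat n < T \<omega>})"
proof -
  have "path_law \<X> p \<theta>\<^sub>0 \<theta>\<^sub>0 \<infinity> = law \<infinity>" by (simp add: path_law_def)
  then show ?thesis
    unfolding ARL_def by (simp add: nn_integral_enat_function[OF T_measurable] space_path_law)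
qed

text \<open>Otherwise the window probabilities would sum to at least \<open>2 m / \<gamma>\<close>
  times the average run length, hence to at least \<open>2 m\<close>, against the bound
  \<open>m\<close>. The factor 2 makes the contradiction strict.\<close>

lemma exists_quiet_history:
  assumes ARL: "ARL \<X> p \<theta>\<^sub>0 T \<ge> ennreal \<gamma>" and "\<gamma> > 0" "m > 0"
  obtains h where "emeasure (law \<infinity>) (cylinder h) > 0"
    and "hit (kernel \<theta>\<^sub>0) stopped m h \<le> 2 * real m / \<gamma>"
proof (rule ccontr)
  let ?\<beta> = "2 * real m / \<gamma>"
  assume "\<not> thesis"
  then have hit: "\<And>h. emeasure (law \<infinity>) (cylinder h) > 0 \<Longrightarrow> ?\<beta> \<le> hit (kernel \<theta>\<^sub>0) stopped m h"
    using that by (meson linear)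
  have "ennreal (2 * real m) = ennreal ?\<beta> * ennreal \<gamma>"
    using assms by (simp add: ennreal_mult'[symmetric])
  also have "\<dots> \<le> ennreal ?\<beta> * ARL \<X> p \<theta>\<^sub>0 T"
    using ARL by (intro mult_left_mono) auto
  also have "\<dots> = (\<Sum>n. ennreal ?\<beta> * emeasure (law \<infinity>) {\<omega> \<in> paths \<X>. enat n < T \<omega>})"
    unfolding ARL_eq by (rule ennreal_suminf_cmult[symmetric])
  also have "\<dots> \<le> (\<Sum>n. emeasure (law \<infinity>) {\<omega> \<in> paths \<X>. enat n < T \<omega> \<and> T \<omega> \<le> enat (n + m)})"
    by (intro suminf_le window_probability hit) auto
  also have "\<dots> \<le> ennreal (real m)"
    by (rule sum_windows_le)
  finally show False using \<open>m > 0\<close> by (simp add: ennreal_le_iff)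
qed

lemma WADD_lower_bound:
  assumes K: "\<And>\<tau>. \<tau> \<in> {\<tau>min..\<tau>max} \<Longrightarrow> bit_KL \<X> p \<theta>\<^sub>0 \<theta>\<^sub>1 \<tau> \<le> ereal K" "0 \<le> K"
    and ARL: "ARL \<X> p \<theta>\<^sub>0 T \<ge> ennreal \<gamma>" and \<gamma>: "\<gamma> > 1"
    and l: "l = ln (\<gamma> / (2 * ((ln \<gamma>)\<^sup>2 + 1)))" "l > 0"
  shows "ennreal ((l - ln 2) / (K + l / (ln \<gamma>)\<^sup>2)) \<le> WADD \<X> p \<theta>\<^sub>0 \<theta>\<^sub>1 \<pi> T"
proof -
  \<comment> \<open>The window is long against \<open>ln \<gamma>\<close>, so the Markov loss
    \<open>l / r\<close> vanishes, yet short enough that dividing \<open>\<gamma>\<close> by it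
    changes \<open>l\<close> only to lower order.\<close>
  define r where "r = (ln \<gamma>)\<^sup>2"
  define m where "m = nat \<lceil>r\<rceil>"
  have r: "r > 0" using \<gamma> by (simp add: r_def)
  have m: "m > 0" "r \<le> real m" "real m \<le> r + 1"
    using r by (auto simp: m_def)
  obtain h where h: "emeasure (law \<infinity>) (cylinder h) > 0"
    "hit (kernel \<theta>\<^sub>0) stopped m h \<le> 2 * real m / \<gamma>"
    using exists_quiet_history[OF ARL _ m(1)] \<gamma> by auto
  have "exp l = \<gamma> / (2 * (r + 1))"
    using \<gamma> r unfolding l(1) r_def[symmetric] by (intro exp_ln) (auto intro!: divide_pos_pos)
  \<comment> \<open>The \<open>+ 1\<close> in \<open>l\<close> absorbs the ceiling:
    \<open>m \<le> r + 1\<close> makes the product at most one.\<close>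
  then have "exp l * hit (kernel \<theta>\<^sub>0) stopped m h \<le> \<gamma> / (2 * (r + 1)) * (2 * real m / \<gamma>)"
    using h(2) \<gamma> r by (simp only:) (intro mult_left_mono, auto)
  also have "\<dots> \<le> 1"
    using \<gamma> r m by (simp add: field_simps)
  finally have small: "exp l * hit (kernel \<theta>\<^sub>0) stopped m h \<le> 1" .
  \<comment> \<open>\<open>threshold_bounds\<close> covers all histories, so the divergence bound
    holds at every node of the tree.\<close>
  have KL: "kl_term (kernel \<theta>\<^sub>1 h' True) (kernel \<theta>\<^sub>0 h' True)
      + kl_term (kernel \<theta>\<^sub>1 h' False) (kernel \<theta>\<^sub>0 h' False) \<le> ereal K" for h'
    using K(1)[OF threshold_bounds[of h']] density_pre density_post
    by (simp add: bit_KL_def kernel_eq_bit_prob add.commute)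
  have "l - ln 2 \<le> delay (kernel \<theta>\<^sub>1) stopped m h * (K + l / r)"
    by (rule delay_lower_bound[OF bit_kernel_kernel[OF density_post] bit_kernel_kernel[OF density_pre]
          KL less_imp_le[OF l(2)] small m(1) r m(2)])
  moreover have "K + l / r > 0"
    using K l r by (intro add_nonneg_pos divide_pos_pos) auto
  ultimately have "(l - ln 2) / (K + l / r) \<le> delay (kernel \<theta>\<^sub>1) stopped m h"
    by (simp add: pos_divide_le_eq)
  then have "ennreal ((l - ln 2) / (K + l / r)) \<le> ennreal (delay (kernel \<theta>\<^sub>1) stopped m h)"
    by (rule ennreal_leI)
  also have "\<dots> \<le> WADD \<X> p \<theta>\<^sub>0 \<theta>\<^sub>1 \<pi> T"
    by (rule delay_le_WADD[OF h(1)])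
  finally show ?thesis by (simp add: r_def)
qed

end

section \<open>Nonnegativity of the divergence and the limit in \<gamma>\<close>

lemma bit_prob_distribution:
  assumes "\<X> \<in> sets borel" "density_on \<X> (\<lambda>x. p x \<theta>)"
  shows "bit_prob \<X> p (-1) \<theta> c \<ge> 0" "bit_prob \<X> p 1 \<theta> c \<ge> 0"
    "bit_prob \<X> p (-1) \<theta> c + bit_prob \<X> p 1 \<theta> c = 1"
proof -
  have eq: "bit_prob \<X> p (if b then 1 else -1) \<theta> c = measure (sample_law \<X> p \<theta>) (\<X> \<inter> bit_side b c)" for b
    using assms by (rule bit_prob_eq_measure)
  have "measure (sample_law \<X> p \<theta>) (\<X> \<inter> bit_side True c)
    + measure (sample_law \<X> p \<theta>) (\<X> \<inter> bit_side False c) = 1"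
    using assms by (rule sample_law_sides)
  then show "bit_prob \<X> p (-1) \<theta> c \<ge> 0" "bit_prob \<X> p 1 \<theta> c \<ge> 0"
      "bit_prob \<X> p (-1) \<theta> c + bit_prob \<X> p 1 \<theta> c = 1"
    using eq[of True] eq[of False] by (simp_all add: add.commute)
qed

text \<open>Gibbs' inequality: the Donsker-Varadhan bound with
  \<open>g\<^sub>0 = g\<^sub>1 = 1\<close>, where all logarithms of \<open>g\<close> and of its mean
  vanish.\<close>

lemma bit_KL_upper_bound_nonneg:
  assumes "\<X> \<in> sets borel" "density_on \<X> (\<lambda>x. p x \<theta>\<^sub>0)" "density_on \<X> (\<lambda>x. p x \<theta>)"
    and "bit_KL \<X> p \<theta>\<^sub>0 \<theta> \<tau> \<le> ereal K"
  shows "0 \<le> K"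
proof -
  note pre = bit_prob_distribution[where p = p and \<theta> = \<theta>\<^sub>0 and c = \<tau>, OF assms(1,2)]
  note post = bit_prob_distribution[where p = p and \<theta> = \<theta> and c = \<tau>, OF assms(1,3)]
  have "kl_term (bit_prob \<X> p (-1) \<theta> \<tau>) (bit_prob \<X> p (-1) \<theta>\<^sub>0 \<tau>)
      + kl_term (bit_prob \<X> p 1 \<theta> \<tau>) (bit_prob \<X> p 1 \<theta>\<^sub>0 \<tau>) \<le> ereal K"
    using assms(4) by (simp add: bit_KL_def)
  from binary_Donsker_Varadhan[OF post pre zero_less_one zero_less_one this] show ?thesis
    using pre(3) by simp
qed

theorem theorem1:
  fixes \<X> \<Theta> \<Theta>\<^sub>1 :: "real set"
    and p :: "real \<Rightarrow> real \<Rightarrow> real"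
    and \<theta>\<^sub>0 \<theta>\<^sub>1 \<tau>min \<tau>max :: real
    and KL\<^sub>M :: ereal
  assumes "\<X> \<in> sets borel"
    and "\<And>\<theta>. \<theta> \<in> \<Theta> \<Longrightarrow> density_on \<X> (\<lambda>x. p x \<theta>)"
    and "\<theta>\<^sub>0 \<in> \<Theta>"
    and "compact \<Theta>\<^sub>1" and "\<Theta>\<^sub>1 \<subseteq> \<Theta>" and "\<theta>\<^sub>0 \<notin> \<Theta>\<^sub>1"
    and "\<theta>\<^sub>1 \<in> \<Theta>\<^sub>1"
    and "\<tau>min \<in> \<X>" and "\<tau>max \<in> \<X>" and "\<tau>min \<le> \<tau>max"
    and KL\<^sub>M: "KL\<^sub>M = (SUP \<tau>\<in>{\<tau>min..\<tau>max}. bit_KL \<X> p \<theta>\<^sub>0 \<theta>\<^sub>1 \<tau>)"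
  shows "\<exists>c :: real \<Rightarrow> ereal. (c \<longlongrightarrow> inverse KL\<^sub>M) at_top \<and>
    (\<forall>\<^sub>F \<gamma> in at_top.
       enn2ereal (INF (\<pi>, T) \<in> {(\<pi>, T) \<in> joint_procedures \<X> \<tau>min \<tau>max. ARL \<X> p \<theta>\<^sub>0 T \<ge> ennreal \<gamma>}.
         WADD \<X> p \<theta>\<^sub>0 \<theta>\<^sub>1 \<pi> T)
       \<ge> c \<gamma> * ereal (ln \<gamma>))"
proof (cases "KL\<^sub>M = \<infinity>")
  case True
  \<comment> \<open>Here \<open>inverse KL\<^sub>M = 0\<close>, so the zero function will
    do.\<close>
  then show ?thesis by (intro exI[of _ "\<lambda>_. 0"]) simp
next
  case False
  have dens: "density_on \<X> (\<lambda>x. p x \<theta>\<^sub>0)" "density_on \<X> (\<lambda>x. p x \<theta>\<^sub>1)"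
    using assms by auto
  have le: "bit_KL \<X> p \<theta>\<^sub>0 \<theta>\<^sub>1 \<tau> \<le> KL\<^sub>M" if "\<tau> \<in> {\<tau>min..\<tau>max}" for \<tau>
    unfolding KL\<^sub>M using that by (rule SUP_upper)
  have nonneg: "0 \<le> K" if "KL\<^sub>M \<le> ereal K" for K
    using bit_KL_upper_bound_nonneg[OF assms(1) dens order.trans[OF le that]] assms(10) by auto
  obtain K where K: "KL\<^sub>M = ereal K" "0 \<le> K"
  proof (cases KL\<^sub>M)
    case MInf
    \<comment> \<open>A supremum of \<open>-\<infinity>\<close> would make \<open>-1\<close> an
      upper bound, yet upper bounds are nonnegative.\<close>
    with nonneg[of "- 1"] show ?thesis by simp
  qed (use False nonneg in auto)
  define l where "l = (\<lambda>x::real. ln (x / (2 * ((ln x)\<^sup>2 + 1))))"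
  define v where "v = (\<lambda>x. (l x - ln 2) / (K + l x / (ln x)\<^sup>2))"
  have "((\<lambda>x. ereal (v x / ln x)) \<longlongrightarrow> inverse KL\<^sub>M) at_top"
    using lower_bound_asymptotics[OF K(2)] by (simp add: v_def l_def K(1))
  moreover have "filterlim l at_top at_top"
    unfolding l_def by real_asymp
  \<comment> \<open>\<open>l \<gamma> \<ge> ln 2\<close> makes \<open>v \<gamma>\<close>
    nonnegative, so converting it to \<open>ennreal\<close> and back loses nothing.\<close>
  then have "\<forall>\<^sub>F \<gamma> in at_top. l \<gamma> \<ge> ln 2"
    by (simp add: filterlim_at_top)
  then have "\<forall>\<^sub>F \<gamma> in at_top. ereal (v \<gamma> / ln \<gamma>) * ereal (ln \<gamma>)
      \<le> enn2ereal (INF (\<pi>, T) \<in> {(\<pi>, T) \<in> joint_procedures \<X> \<tau>min \<tau>max. ARL \<X> p \<theta>\<^sub>0 T \<ge> ennreal \<gamma>}.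
         WADD \<X> p \<theta>\<^sub>0 \<theta>\<^sub>1 \<pi> T)" (is "\<forall>\<^sub>F \<gamma> in _. _ \<le> enn2ereal (?I \<gamma>)")
    using eventually_gt_at_top[of 1]
  proof eventually_elim
    case (elim \<gamma>)
    have l: "l \<gamma> > 0" using elim(1) ln_gt_zero[of 2] by linarith
    have "ennreal (v \<gamma>) \<le> ?I \<gamma>"
    proof (rule INF_greatest, clarify)
      fix \<pi> T assume joint: "(\<pi>, T) \<in> joint_procedures \<X> \<tau>min \<tau>max" and ARL: "ennreal \<gamma> \<le> ARL \<X> p \<theta>\<^sub>0 T"
      interpret one_bit_procedure \<X> p \<theta>\<^sub>0 \<theta>\<^sub>1 \<tau>min \<tau>max \<pi> T
        by (rule one_bit_procedure.intro[OF assms(1) dens assms(10) joint])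
      show "ennreal (v \<gamma>) \<le> WADD \<X> p \<theta>\<^sub>0 \<theta>\<^sub>1 \<pi> T"
        unfolding v_def using le K l elim ARL by (intro WADD_lower_bound) (auto simp: l_def)
    qed
    moreover have "v \<gamma> \<ge> 0"
      using elim K(2) l by (auto simp: v_def intro!: divide_nonneg_nonneg add_nonneg_nonneg)
    ultimately have "ereal (v \<gamma>) \<le> enn2ereal (?I \<gamma>)"
      by (simp add: less_eq_ennreal.rep_eq enn2ereal_ennreal)
    with elim(2) show ?case by simp
  qed
  ultimately show ?thesis by blast
qed

end
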